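(* Let $e$ be an idempotent in a ring $R$ (not necessarily unital). If $R$ is purely infinite, then so is $eRe$. If $R$ is properly purely infinite, then so is $eRe$.
   Context: Rings are associative and not necessarily unital. For $a\in R$, $RaR$ denotes the set of finite sums $\sum_i r_ias_i$ with $r_i,s_i\in R$. A ring $R$ is purely infinite if (i) no quotient of $R$ is a division ring, and (ii) whenever $a\in R$ and $b\in RaR$, there exist $x,y\in R$ with $b=xay$. An element $a\in R$ is properly infinite if $a\neq 0$ and there exist $\alpha_1,\alpha_2,\beta_1,\beta_2\in R$ with $\alpha_i a\beta_j=\delta_{ij}a$ for all $i,j\in\{1,2\}$. A ring is properly purely infinite if every nonzero element of it is properly infinite. *)

theory Defs
  imports "HOL-Algebra.QuotRing"
begin

text \<open>
  Rings here are associative but need not have a unit. They are carried by the \<^type>\<open>ring_ext\<close>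
  records of HOL-Algebra, whose \<^const>\<open>one\<close> field is unconstrained and is never used for them.
\<close>

locale rng = abelian_group R for R (structure) +
  assumes m_closed: "\<lbrakk>x \<in> carrier R; y \<in> carrier R\<rbrakk> \<Longrightarrow> x \<otimes> y \<in> carrier R"
    and m_assoc: "\<lbrakk>x \<in> carrier R; y \<in> carrier R; z \<in> carrier R\<rbrakk> \<Longrightarrow> (x \<otimes> y) \<otimes> z = x \<otimes> (y \<otimes> z)"
    and l_distr: "\<lbrakk>x \<in> carrier R; y \<in> carrier R; z \<in> carrier R\<rbrakk> \<Longrightarrow> (x \<oplus> y) \<otimes> z = x \<otimes> z \<oplus> y \<otimes> z"
    and r_distr: "\<lbrakk>x \<in> carrier R; y \<in> carrier R; z \<in> carrier R\<rbrakk> \<Longrightarrow> z \<otimes> (x \<oplus> y) = z \<otimes> x \<oplus> z \<otimes> y"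

locale rng_ideal = additive_subgroup I R + rng R for I and R (structure) +
  assumes I_l_closed: "\<lbrakk>a \<in> I; x \<in> carrier R\<rbrakk> \<Longrightarrow> x \<otimes> a \<in> I"
    and I_r_closed: "\<lbrakk>a \<in> I; x \<in> carrier R\<rbrakk> \<Longrightarrow> a \<otimes> x \<in> I"

text \<open>
  The unit of a division ring is existentially quantified, since the \<^const>\<open>one\<close> field of a
  possibly non-unital ring (in particular, of a quotient \<open>R Quot I\<close> of one) carries no information.
  The zero ring is excluded: there \<^const>\<open>Units\<close> is the whole carrier.
\<close>

definition is_division_ring :: "('a, 'b) ring_scheme \<Rightarrow> bool" where
  "is_division_ring D \<longleftrightarrow>
     (\<exists>u \<in> carrier D. ring (D\<lparr>one := u\<rparr>) \<and> Units (D\<lparr>one := u\<rparr>) = carrier D - {\<zero>\<^bsub>D\<^esub>})"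

text \<open>The set \<open>RaR\<close> of finite sums of products \<open>ras\<close>.\<close>

definition two_sided_multiples :: "('a, 'b) ring_scheme \<Rightarrow> 'a \<Rightarrow> 'a set" where
  "two_sided_multiples R a =
     {\<Oplus>\<^bsub>R\<^esub>i \<in> {..<n}. r i \<otimes>\<^bsub>R\<^esub> a \<otimes>\<^bsub>R\<^esub> s i | (n :: nat) r s.
        r \<in> {..<n} \<rightarrow> carrier R \<and> s \<in> {..<n} \<rightarrow> carrier R}"

locale purely_infinite_ring = rng R for R (structure) +
  assumes no_division_ring_quotient: "rng_ideal I R \<Longrightarrow> \<not> is_division_ring (R Quot I)"
    and multiples: "\<lbrakk>a \<in> carrier R; b \<in> two_sided_multiples R a\<rbrakk>
      \<Longrightarrow> \<exists>x \<in> carrier R. \<exists>y \<in> carrier R. b = x \<otimes> a \<otimes> y"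

definition properly_infinite :: "('a, 'b) ring_scheme \<Rightarrow> 'a \<Rightarrow> bool" where
  "properly_infinite R a \<longleftrightarrow> a \<in> carrier R \<and> a \<noteq> \<zero>\<^bsub>R\<^esub> \<and>
     (\<exists>\<alpha> \<beta>. \<alpha> \<in> {1, 2 :: nat} \<rightarrow> carrier R \<and> \<beta> \<in> {1, 2 :: nat} \<rightarrow> carrier R \<and>
        (\<forall>i \<in> {1, 2}. \<forall>j \<in> {1, 2}.
           \<alpha> i \<otimes>\<^bsub>R\<^esub> a \<otimes>\<^bsub>R\<^esub> \<beta> j = (if i = j then a else \<zero>\<^bsub>R\<^esub>)))"

locale properly_purely_infinite_ring = rng R for R (structure) +
  assumes properly_infinite: "\<lbrakk>a \<in> carrier R; a \<noteq> \<zero>\<rbrakk> \<Longrightarrow> properly_infinite R a"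

text \<open>The corner ring \<open>eRe\<close>, with the operations of \<open>R\<close>; for idempotent \<open>e\<close> its unit is \<open>e\<close>.\<close>

definition corner :: "('a, 'b) ring_scheme \<Rightarrow> 'a \<Rightarrow> ('a, 'b) ring_scheme" where
  "corner R e = R\<lparr>carrier := {e \<otimes>\<^bsub>R\<^esub> r \<otimes>\<^bsub>R\<^esub> e | r. r \<in> carrier R}, one := e\<rparr>"

end

theory Submission
  imports Defs
begin

text \<open>
  Everything except the condition on division ring quotients follows by multiplying witnesses on
  both sides by \<open>e\<close>. If \<open>a\<close> lies in the corner, then \<open>(exe)a(eye) = e(xay)e\<close>; so an equation
  \<open>b = xay\<close> in \<open>R\<close> with \<open>b\<close> in the corner yields \<open>b = (exe)a(eye)\<close>, and likewise for the four
  equations that make \<open>a\<close> properly infinite.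

  For the remaining condition, let \<open>I\<close> be an ideal of \<open>eRe\<close> such that \<open>eRe/I\<close> is a division ring.
  Then \<open>R\<close> would have the same division ring as a quotient. The map that realizes it is
  compression, \<open>x \<mapsto> exe + I\<close>. It is additive and onto \<open>eRe/I\<close>, but in a general ring it is not
  multiplicative: the defect is \<open>exye - (exe)(eye) = uv\<close> with \<open>u = ex - exe\<close> and
  \<open>v = ye - eye\<close>, the off-diagonal Peirce components of \<open>x\<close> and \<open>y\<close>. Pure infiniteness forces
  \<open>uv \<in> I\<close> (lemma \<open>orthogonal_product_in_ideal\<close>). Indeed \<open>h = e + vu\<close> lies in \<open>ReR\<close>, so it has the
  form \<open>xey\<close> and should behave as an element of rank one, whereas \<open>uv \<notin> I\<close> would give it rank two
  over the division ring \<open>eRe/I\<close>. Hence compression is a surjective homomorphism onto a division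
  ring, its kernel \<open>{x. exe \<in> I}\<close> is an ideal of \<open>R\<close>, and the quotient of \<open>R\<close> by it is a division
  ring, which is impossible.
\<close>

section \<open>Rings without unit and their quotients\<close>

context rng
begin

lemma m_lnull: "x \<in> carrier R \<Longrightarrow> \<zero> \<otimes> x = \<zero>"
  by (metis l_distr add.l_cancel_one add.one_closed m_closed r_zero)

lemma m_rnull: "x \<in> carrier R \<Longrightarrow> x \<otimes> \<zero> = \<zero>"
  by (metis r_distr add.l_cancel_one add.one_closed m_closed r_zero)

lemma m_lminus: "\<lbrakk>x \<in> carrier R; y \<in> carrier R\<rbrakk> \<Longrightarrow> (\<ominus> x) \<otimes> y = \<ominus> (x \<otimes> y)"
  by (metis a_inv_closed l_distr l_neg m_closed m_lnull minus_equality)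

lemma m_rminus: "\<lbrakk>x \<in> carrier R; y \<in> carrier R\<rbrakk> \<Longrightarrow> x \<otimes> (\<ominus> y) = \<ominus> (x \<otimes> y)"
  by (metis a_inv_closed r_distr l_neg m_closed m_rnull minus_equality)

lemma diff_distr_left:
  "\<lbrakk>x \<in> carrier R; y \<in> carrier R; z \<in> carrier R\<rbrakk> \<Longrightarrow> (x \<ominus> y) \<otimes> z = x \<otimes> z \<ominus> y \<otimes> z"
  by (simp add: a_minus_def l_distr m_lminus)

lemma diff_distr_right:
  "\<lbrakk>x \<in> carrier R; y \<in> carrier R; z \<in> carrier R\<rbrakk> \<Longrightarrow> z \<otimes> (x \<ominus> y) = z \<otimes> x \<ominus> z \<otimes> y"
  by (simp add: a_minus_def r_distr m_rminus)

lemma diff_self: "x \<in> carrier R \<Longrightarrow> x \<ominus> x = \<zero>"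
  by (simp add: a_minus_def r_neg)

text \<open>An intrinsic description that no longer involves the \<open>one\<close> field of the record.\<close>

lemma is_division_ring_iff:
  "is_division_ring R \<longleftrightarrow>
     (\<exists>u \<in> carrier R. u \<noteq> \<zero> \<and> (\<forall>x \<in> carrier R. u \<otimes> x = x \<and> x \<otimes> u = x) \<and>
        (\<forall>x \<in> carrier R - {\<zero>}. \<exists>y \<in> carrier R. x \<otimes> y = u \<and> y \<otimes> x = u))"
proof
  assume "is_division_ring R"
  then obtain u where u: "u \<in> carrier R" "ring (R\<lparr>one := u\<rparr>)"
      "Units (R\<lparr>one := u\<rparr>) = carrier R - {\<zero>}"
    unfolding is_division_ring_def by blast
  interpret U: ring "R\<lparr>one := u\<rparr>" by (rule u(2))
  have "u \<noteq> \<zero>" using U.Units_one_closed u(3) by simp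
  moreover have "u \<otimes> x = x \<and> x \<otimes> u = x" if "x \<in> carrier R" for x
    using U.l_one U.r_one that by simp
  moreover have "\<exists>y \<in> carrier R. x \<otimes> y = u \<and> y \<otimes> x = u" if "x \<in> carrier R - {\<zero>}" for x
  proof -
    have "x \<in> Units (R\<lparr>one := u\<rparr>)" using that u(3) by simp
    then show ?thesis unfolding Units_def by auto
  qed
  ultimately show "\<exists>u \<in> carrier R. u \<noteq> \<zero> \<and> (\<forall>x \<in> carrier R. u \<otimes> x = x \<and> x \<otimes> u = x) \<and>
        (\<forall>x \<in> carrier R - {\<zero>}. \<exists>y \<in> carrier R. x \<otimes> y = u \<and> y \<otimes> x = u)"
    using u(1) by blast
next
  assume "\<exists>u \<in> carrier R. u \<noteq> \<zero> \<and> (\<forall>x \<in> carrier R. u \<otimes> x = x \<and> x \<otimes> u = x) \<and>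
        (\<forall>x \<in> carrier R - {\<zero>}. \<exists>y \<in> carrier R. x \<otimes> y = u \<and> y \<otimes> x = u)"
  then obtain u where u: "u \<in> carrier R" "u \<noteq> \<zero>"
      "\<And>x. x \<in> carrier R \<Longrightarrow> u \<otimes> x = x" "\<And>x. x \<in> carrier R \<Longrightarrow> x \<otimes> u = x"
      "\<And>x. \<lbrakk>x \<in> carrier R; x \<noteq> \<zero>\<rbrakk> \<Longrightarrow> \<exists>y \<in> carrier R. x \<otimes> y = u \<and> y \<otimes> x = u"
    by blast
  have "ring (R\<lparr>one := u\<rparr>)"
  proof (rule ringI)
    show "abelian_group (R\<lparr>one := u\<rparr>)"
      by (rule abelian_groupI) (auto simp: a_ac intro: l_neg)
    show "Group.monoid (R\<lparr>one := u\<rparr>)"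
      by (rule monoidI) (auto simp: m_closed m_assoc u)
  qed (auto simp: l_distr r_distr)
  moreover have "Units (R\<lparr>one := u\<rparr>) = carrier R - {\<zero>}"
    using u(2,5) by (auto simp: Units_def m_lnull)
  ultimately show "is_division_ring R"
    unfolding is_division_ring_def using u(1) by blast
qed

end

sublocale rng_ideal \<subseteq> abelian_subgroup I R
  by (rule abelian_subgroupI3[OF is_additive_subgroup abelian_group_axioms])

context rng_ideal
begin

lemma coset_eq_iff:
  assumes "x \<in> carrier R" "y \<in> carrier R"
  shows "I +> x = I +> y \<longleftrightarrow> x \<ominus> y \<in> I"
  using assms by (metis a_minus_def a_rcos_module a_repr_independence' a_rcos_self)

lemma mem_diff_trans:
  assumes "x \<in> carrier R" "y \<in> carrier R" "x \<ominus> y \<in> I"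
  shows "x \<in> I \<longleftrightarrow> y \<in> I"
proof -
  have "I +> x = I +> y" using assms coset_eq_iff by simp
  then show ?thesis using assms a_rcos_const a_rcos_self by metis
qed

lemma rcoset_mult_coset:
  assumes "x \<in> carrier R" "y \<in> carrier R"
  shows "rcoset_mult R I (I +> x) (I +> y) = I +> (x \<otimes> y)"
proof -
  have "I +> (x' \<otimes> y') = I +> (x \<otimes> y)" if "x' \<in> I +> x" "y' \<in> I +> y" for x' y'
  proof -
    from that obtain h k where h: "h \<in> I" "x' = h \<oplus> x" and k: "k \<in> I" "y' = k \<oplus> y"
      by (auto simp: a_r_coset_def')
    have c: "h \<in> carrier R" "k \<in> carrier R" using h k by auto
    have "x' \<otimes> y' = (h \<otimes> (k \<oplus> y) \<oplus> x \<otimes> k) \<oplus> x \<otimes> y"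
      using assms c by (simp add: h k l_distr r_distr m_closed a_ac)
    moreover have "h \<otimes> (k \<oplus> y) \<oplus> x \<otimes> k \<in> I"
      using assms c h k by (simp add: I_l_closed I_r_closed)
    ultimately have "x' \<otimes> y' \<in> I +> (x \<otimes> y)"
      by (auto simp: a_r_coset_def')
    then show ?thesis using assms m_closed a_repr_independence' by metis
  qed
  moreover have "x \<in> I +> x" "y \<in> I +> y" using assms a_rcos_self by auto
  ultimately show ?thesis unfolding rcoset_mult_def by blast
qed

lemma quotient_carrier: "carrier (R Quot I) = (\<lambda>x. I +> x) ` carrier R"
  by (auto simp: FactRing_def A_RCOSETS_def')

lemma quotient_rng: "rng (R Quot I)"
proof -
  have "abelian_group (R Quot I)"
    by (rule comm_group_abelian_groupI)
      (simp add: FactRing_def a_factorgroup_is_comm_group[unfolded A_FactGroup_def'])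
  then show ?thesis
    by (intro rng.intro rng_axioms.intro)
      (auto simp: FactRing_simps rcoset_mult_coset a_rcos_sum m_closed m_assoc l_distr r_distr)
qed

text \<open>Being a division ring is read off from representatives, so that quotients of different rings
  can be compared without an isomorphism between them.\<close>

lemma quotient_is_division_ring_iff:
  "is_division_ring (R Quot I) \<longleftrightarrow>
     (\<exists>u \<in> carrier R. u \<notin> I \<and> (\<forall>x \<in> carrier R. u \<otimes> x \<ominus> x \<in> I \<and> x \<otimes> u \<ominus> x \<in> I) \<and>
        (\<forall>x \<in> carrier R - I. \<exists>y \<in> carrier R. x \<otimes> y \<ominus> u \<in> I \<and> y \<otimes> x \<ominus> u \<in> I))"
proof -
  \<comment> \<open>All conditions on cosets become conditions on representatives; the zero coset is \<open>I\<close>.\<close>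
  have zero: "\<zero>\<^bsub>R Quot I\<^esub> = I" and mult: "mult (R Quot I) = rcoset_mult R I"
    by (simp_all add: FactRing_def)
  have eq_zero: "I +> x = I \<longleftrightarrow> x \<in> I" if "x \<in> carrier R" for x
    using that a_rcos_const a_rcos_self by metis
  have nonzero: "(\<forall>x \<in> (\<lambda>x. I +> x) ` carrier R - {I}. P x) \<longleftrightarrow>
      (\<forall>x \<in> carrier R - I. P (I +> x))" for P
    using eq_zero by auto
  show ?thesis
    unfolding rng.is_division_ring_iff[OF quotient_rng] quotient_carrier zero mult nonzero
    by (simp add: rcoset_mult_coset coset_eq_iff[symmetric] m_closed eq_zero cong: bex_cong conj_cong)
qed

text \<open>A division ring has no zero divisors: multiply \<open>xy \<in> I\<close> on the right by an inverse of \<open>y\<close>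
  modulo \<open>I\<close>.\<close>

lemma prime_if_quotient_division:
  assumes "is_division_ring (R Quot I)" "x \<in> carrier R" "y \<in> carrier R" "x \<otimes> y \<in> I"
  shows "x \<in> I \<or> y \<in> I"
proof (rule disjCI)
  assume "y \<notin> I"
  obtain u where u: "u \<in> carrier R" "\<And>x. x \<in> carrier R \<Longrightarrow> x \<otimes> u \<ominus> x \<in> I"
      "\<And>x. x \<in> carrier R - I \<Longrightarrow> \<exists>y \<in> carrier R. x \<otimes> y \<ominus> u \<in> I"
    using assms(1) unfolding quotient_is_division_ring_iff by blast
  obtain z where z: "z \<in> carrier R" "y \<otimes> z \<ominus> u \<in> I"
    using u(3) \<open>y \<notin> I\<close> assms(3) by blast
  have "x \<otimes> (y \<otimes> z \<ominus> u) \<in> I"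
    using z assms I_l_closed by blast
  then have "x \<otimes> y \<otimes> z \<ominus> x \<otimes> u \<in> I"
    using z u(1) assms by (simp add: diff_distr_right m_closed m_assoc)
  moreover have "x \<otimes> y \<otimes> z \<in> I"
    using assms z I_r_closed by blast
  ultimately have "x \<otimes> u \<in> I"
    using mem_diff_trans assms z u(1) m_closed by metis
  then show "x \<in> I"
    using mem_diff_trans[of "x \<otimes> u" x] u assms m_closed by blast
qed

end

section \<open>The corner ring\<close>

locale rng_idempotent = rng R for R (structure) +
  fixes e
  assumes e_closed: "e \<in> carrier R" and e_idem: "e \<otimes> e = e"
begin

lemma e_left: "x \<in> carrier R \<Longrightarrow> e \<otimes> (e \<otimes> x) = e \<otimes> x"
  by (metis e_closed e_idem m_assoc)

lemma corner_simps:
  "mult (corner R e) = mult R" "add (corner R e) = add R" "zero (corner R e) = zero R"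
  by (simp_all add: corner_def)

text \<open>The form in which corner membership is used: it gives rewrite rules instead of a witness.\<close>

lemma mem_corner_iff:
  "x \<in> carrier (corner R e) \<longleftrightarrow> x \<in> carrier R \<and> e \<otimes> x = x \<and> x \<otimes> e = x"
proof
  assume "x \<in> carrier (corner R e)"
  then obtain r where "r \<in> carrier R" "x = e \<otimes> r \<otimes> e" by (auto simp: corner_def)
  then show "x \<in> carrier R \<and> e \<otimes> x = x \<and> x \<otimes> e = x"
    by (simp add: m_assoc m_closed e_closed e_idem e_left)
next
  assume "x \<in> carrier R \<and> e \<otimes> x = x \<and> x \<otimes> e = x"
  then show "x \<in> carrier (corner R e)"
    by (force simp: corner_def)
qed

lemma compress_in_corner: "x \<in> carrier R \<Longrightarrow> e \<otimes> x \<otimes> e \<in> carrier (corner R e)"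
  by (auto simp: corner_def)

lemma corner_rng: "rng (corner R e)"
proof (rule rng.intro)
  show "abelian_group (corner R e)"
  proof (rule abelian_groupI)
    fix x assume x: "x \<in> carrier (corner R e)"
    then have "\<ominus> x \<in> carrier (corner R e)" 
      by (simp add: mem_corner_iff e_closed m_lminus m_rminus)
    then show "\<exists>y \<in> carrier (corner R e). y \<oplus>\<^bsub>corner R e\<^esub> x = \<zero>\<^bsub>corner R e\<^esub>"
      using x by (auto simp: corner_simps mem_corner_iff intro!: bexI[of _ "\<ominus> x"] l_neg)
  qed (auto simp: corner_simps mem_corner_iff e_closed l_distr r_distr a_ac m_lnull m_rnull)
  show "rng_axioms (corner R e)"
  proof (rule rng_axioms.intro)
    fix x y assume "x \<in> carrier (corner R e)" "y \<in> carrier (corner R e)"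
    then show "x \<otimes>\<^bsub>corner R e\<^esub> y \<in> carrier (corner R e)"
      by (simp add: mem_corner_iff corner_simps e_closed m_closed m_assoc)
        (metis e_closed m_assoc)
  qed (auto simp: corner_simps mem_corner_iff m_assoc l_distr r_distr)
qed

sublocale C: rng "corner R e"
  by (rule corner_rng)

text \<open>Negation and finite sums are defined from the whole record, its carrier included, so their
  agreement with those of the big ring does not hold by definition.\<close>

lemma corner_minus:
  assumes "x \<in> carrier (corner R e)" "y \<in> carrier (corner R e)"
  shows "x \<ominus>\<^bsub>corner R e\<^esub> y = x \<ominus> y"
proof -
  have "\<ominus>\<^bsub>corner R e\<^esub> y \<in> carrier (corner R e)" using assms by simp
  moreover have "\<ominus>\<^bsub>corner R e\<^esub> y \<oplus> y = \<zero>"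
    using C.l_neg[OF assms(2)] by (simp add: corner_simps)
  ultimately have "\<ominus>\<^bsub>corner R e\<^esub> y = \<ominus> y"
    using assms by (metis mem_corner_iff minus_equality)
  then show ?thesis by (simp add: a_minus_def corner_simps)
qed

lemma corner_finsum:
  assumes "finite A" "f \<in> A \<rightarrow> carrier (corner R e)"
  shows "finsum (corner R e) f A = finsum R f A"
  using assms
proof (induction A rule: finite_induct)
  case (insert a A)
  moreover have "f \<in> A \<rightarrow> carrier R" "f a \<in> carrier R"
    using insert.prems by (auto simp: Pi_iff mem_corner_iff)
  ultimately show ?case
    by (simp add: corner_simps)
qed (simp add: corner_simps)

lemma corner_multiples_subset:
  assumes "a \<in> carrier (corner R e)"
  shows "two_sided_multiples (corner R e) a \<subseteq> two_sided_multiples R a \<inter> carrier (corner R e)"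
proof
  fix b assume "b \<in> two_sided_multiples (corner R e) a"
  then obtain n r s where rs: "r \<in> {..<n::nat} \<rightarrow> carrier (corner R e)"
      "s \<in> {..<n} \<rightarrow> carrier (corner R e)"
    and b: "b = finsum (corner R e) (\<lambda>i. r i \<otimes> a \<otimes> s i) {..<n}"
    by (auto simp: two_sided_multiples_def corner_simps)
  have "(\<lambda>i. r i \<otimes> a \<otimes> s i) \<in> {..<n} \<rightarrow> carrier (corner R e)"
    using rs assms C.m_closed by (auto simp: corner_simps Pi_iff)
  then have "b = finsum R (\<lambda>i. r i \<otimes> a \<otimes> s i) {..<n}" "b \<in> carrier (corner R e)"
    unfolding b using corner_finsum[OF finite_lessThan] C.finsum_closed by blast+
  moreover have "r \<in> {..<n} \<rightarrow> carrier R" "s \<in> {..<n} \<rightarrow> carrier R"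
    using rs by (auto simp: Pi_iff mem_corner_iff)
  ultimately show "b \<in> two_sided_multiples R a \<inter> carrier (corner R e)"
    unfolding two_sided_multiples_def by blast
qed

text \<open>The inner copies of \<open>e\<close> are absorbed by \<open>a\<close>, since \<open>ea = a = ae\<close>; this is what carries
  witnesses from \<open>R\<close> down to the corner.\<close>

lemma compress_mult:
  assumes "a \<in> carrier (corner R e)" "x \<in> carrier R" "y \<in> carrier R"
  shows "(e \<otimes> x \<otimes> e) \<otimes> a \<otimes> (e \<otimes> y \<otimes> e) = e \<otimes> (x \<otimes> a \<otimes> y) \<otimes> e"
proof -
  have "e \<otimes> a = a" "a \<otimes> e = a" "a \<in> carrier R" using assms mem_corner_iff by auto
  moreover from this have "e \<otimes> (a \<otimes> z) = a \<otimes> z" "a \<otimes> (e \<otimes> z) = a \<otimes> z" if "z \<in> carrier R" for z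
    using that e_closed by (metis m_assoc)+
  ultimately show ?thesis
    using assms e_closed by (simp add: m_assoc m_closed)
qed

lemma corner_multiples:
  assumes "purely_infinite_ring R" "a \<in> carrier (corner R e)"
    "b \<in> two_sided_multiples (corner R e) a"
  shows "\<exists>x \<in> carrier (corner R e). \<exists>y \<in> carrier (corner R e). b = x \<otimes> a \<otimes> y"
proof -
  have "a \<in> carrier R" "b \<in> two_sided_multiples R a" and b: "b \<in> carrier (corner R e)"
    using assms corner_multiples_subset mem_corner_iff by auto
  then obtain x y where xy: "x \<in> carrier R" "y \<in> carrier R" "b = x \<otimes> a \<otimes> y"
    using purely_infinite_ring.multiples[OF assms(1)] by blast
  have "b = e \<otimes> b \<otimes> e" using b mem_corner_iff by simp
  also have "\<dots> = (e \<otimes> x \<otimes> e) \<otimes> a \<otimes> (e \<otimes> y \<otimes> e)"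
    using compress_mult assms(2) xy by simp
  finally show ?thesis using compress_in_corner xy by blast
qed

lemma corner_properly_infinite:
  assumes "properly_infinite R a" "a \<in> carrier (corner R e)"
  shows "properly_infinite (corner R e) a"
proof -
  obtain \<alpha> \<beta> where ab: "\<alpha> \<in> {1, 2 :: nat} \<rightarrow> carrier R" "\<beta> \<in> {1, 2 :: nat} \<rightarrow> carrier R"
    and eq: "\<And>i j. \<lbrakk>i \<in> {1, 2}; j \<in> {1, 2}\<rbrakk> \<Longrightarrow> \<alpha> i \<otimes> a \<otimes> \<beta> j = (if i = j then a else \<zero>)"
    using assms(1) unfolding properly_infinite_def by blast
  let ?\<alpha> = "\<lambda>i. e \<otimes> \<alpha> i \<otimes> e" and ?\<beta> = "\<lambda>i. e \<otimes> \<beta> i \<otimes> e"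
  have "?\<alpha> i \<otimes> a \<otimes> ?\<beta> j = (if i = j then a else \<zero>)" if "i \<in> {1, 2}" "j \<in> {1, 2}" for i j
  proof -
    have "?\<alpha> i \<otimes> a \<otimes> ?\<beta> j = e \<otimes> (\<alpha> i \<otimes> a \<otimes> \<beta> j) \<otimes> e"
      using compress_mult assms(2) ab that by blast
    then show ?thesis
      using assms(2) eq[OF that] e_closed by (simp add: mem_corner_iff m_lnull m_rnull)
  qed
  moreover have "?\<alpha> \<in> {1, 2} \<rightarrow> carrier (corner R e)" "?\<beta> \<in> {1, 2} \<rightarrow> carrier (corner R e)"
    using ab compress_in_corner by auto
  moreover have "a \<noteq> \<zero>" using assms(1) by (simp add: properly_infinite_def)
  ultimately show ?thesis
    using assms(2) unfolding properly_infinite_def corner_simps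
    by (intro conjI exI[of _ ?\<alpha>] exI[of _ ?\<beta>]) auto
qed

end

section \<open>Division ring quotients of the corner\<close>

lemma (in rng) sum_of_two_multiples:
  assumes "a \<in> carrier R" "r \<in> carrier R" "r' \<in> carrier R" "s \<in> carrier R" "s' \<in> carrier R"
  shows "r \<otimes> a \<otimes> s \<oplus> r' \<otimes> a \<otimes> s' \<in> two_sided_multiples R a"
proof -
  let ?r = "\<lambda>i. if i = 0 then r else r'" and ?s = "\<lambda>i. if i = 0 then s else s'"
  have "{..<2::nat} = {0, 1}" by auto
  then have "(\<Oplus>i \<in> {..<2::nat}. ?r i \<otimes> a \<otimes> ?s i) = r \<otimes> a \<otimes> s \<oplus> r' \<otimes> a \<otimes> s'"
    using assms by (simp add: m_closed)
  moreover have "?r \<in> {..<2::nat} \<rightarrow> carrier R" "?s \<in> {..<2::nat} \<rightarrow> carrier R"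
    using assms by auto
  ultimately show ?thesis
    unfolding two_sided_multiples_def
    by (intro CollectI exI[of _ "2::nat"] exI[of _ ?r] exI[of _ ?s]) simp
qed

locale corner_division_ideal = rng_idempotent + I: rng_ideal I "corner R e" for I +
  assumes division: "is_division_ring (corner R e Quot I)"
begin

lemma e_in_corner: "e \<in> carrier (corner R e)"
  by (simp add: mem_corner_iff e_closed e_idem)

lemma e_notin: "e \<notin> I"
proof
  assume "e \<in> I"
  then have "x \<in> I" if "x \<in> carrier (corner R e)" for x
    using I.I_r_closed[OF \<open>e \<in> I\<close> that] that by (simp add: corner_simps mem_corner_iff)
  then show False using division unfolding I.quotient_is_division_ring_iff by blast
qed

lemma completely_prime:
  "\<lbrakk>x \<in> carrier (corner R e); y \<in> carrier (corner R e); x \<otimes> y \<in> I\<rbrakk> \<Longrightarrow> x \<in> I \<or> y \<in> I"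
  using I.prime_if_quotient_division[OF division] by (simp add: corner_simps)

text \<open>The unit of the quotient is represented by some \<open>u\<close> with \<open>ue - e \<in> I\<close>; as \<open>ue = u\<close>, the
  element \<open>e\<close> represents it too.\<close>

lemma inverse_modulo:
  assumes "x \<in> carrier (corner R e)" "x \<notin> I"
  shows "\<exists>y \<in> carrier (corner R e). x \<otimes> y \<ominus> e \<in> I \<and> y \<otimes> x \<ominus> e \<in> I"
proof -
  note E = e_in_corner
  obtain u where u: "u \<in> carrier (corner R e)" "u \<otimes> e \<ominus>\<^bsub>corner R e\<^esub> e \<in> I"
      "\<And>x. x \<in> carrier (corner R e) - I \<Longrightarrow>
         \<exists>y \<in> carrier (corner R e). x \<otimes> y \<ominus>\<^bsub>corner R e\<^esub> u \<in> I \<and> y \<otimes> x \<ominus>\<^bsub>corner R e\<^esub> u \<in> I"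
    using division E unfolding I.quotient_is_division_ring_iff corner_simps by blast
  have "u \<ominus>\<^bsub>corner R e\<^esub> e \<in> I" using u(1,2) by (simp add: mem_corner_iff)
  then have ue: "a_r_coset (corner R e) I u = a_r_coset (corner R e) I e"
    using I.coset_eq_iff u(1) E by simp
  obtain y where y: "y \<in> carrier (corner R e)"
      "x \<otimes> y \<ominus>\<^bsub>corner R e\<^esub> u \<in> I" "y \<otimes> x \<ominus>\<^bsub>corner R e\<^esub> u \<in> I"
    using u(3) assms by blast
  have c: "x \<otimes> y \<in> carrier (corner R e)" "y \<otimes> x \<in> carrier (corner R e)"
    using C.m_closed assms y(1) by (auto simp: corner_simps)
  have "x \<otimes> y \<ominus>\<^bsub>corner R e\<^esub> e \<in> I" "y \<otimes> x \<ominus>\<^bsub>corner R e\<^esub> e \<in> I"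
    using y(2,3) c u(1) E ue by (simp_all add: I.coset_eq_iff[symmetric])
  then show ?thesis using y(1) c E by (auto simp: corner_minus)
qed

text \<open>
  The rank argument. In a suitable Peirce picture, \<open>u\<close> and \<open>v\<close> are the off-diagonal entries in the
  first row and the first column. Sandwiching \<open>h = e + vu\<close> between the rows \<open>e, u\<close> and the columns
  \<open>e, v\<close> gives a two by two matrix over the corner whose first row is \<open>(e, 0)\<close> and whose last entry
  is \<open>(uv)(uv)\<close>. As \<open>h = xey\<close>, that matrix is also the product of a column \<open>(p, p')\<close> and a row
  \<open>(q, q')\<close>. From \<open>pq = e\<close> and \<open>pq' = 0\<close>, complete primeness of \<open>I\<close> yields \<open>q' \<in> I\<close>, hence
  \<open>(uv)(uv) = p'q' \<in> I\<close>, and so \<open>uv \<in> I\<close>.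
\<close>

lemma orthogonal_product_in_ideal:
  assumes "purely_infinite_ring R"
    and u: "u \<in> carrier R" "e \<otimes> u = u" "u \<otimes> e = \<zero>"
    and v: "v \<in> carrier R" "v \<otimes> e = v" "e \<otimes> v = \<zero>"
  shows "u \<otimes> v \<in> I"
proof (rule ccontr)
  assume notin: "u \<otimes> v \<notin> I"
  define h where "h = e \<oplus> v \<otimes> u"
  have vu: "v \<otimes> u \<in> carrier R" using u v m_closed by blast
  have "h = e \<otimes> e \<otimes> e \<oplus> v \<otimes> e \<otimes> u"
    using u v e_idem by (simp add: h_def)
  then have "h \<in> two_sided_multiples R e"
    using sum_of_two_multiples[of e e v e u] e_closed u v by simp
  then obtain x y where xy: "x \<in> carrier R" "y \<in> carrier R" and h: "h = x \<otimes> e \<otimes> y"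
    using purely_infinite_ring.multiples[OF assms(1) e_closed] by blast
  have uv: "u \<otimes> v \<in> carrier (corner R e)"
    using u v e_closed m_closed by (metis mem_corner_iff m_assoc)
  define p p' q q' where "p = e \<otimes> x \<otimes> e" and "p' = u \<otimes> x \<otimes> e"
    and "q = e \<otimes> y \<otimes> e" and "q' = e \<otimes> y \<otimes> v"
  have mult: "(a \<otimes> x \<otimes> e) \<otimes> (e \<otimes> y \<otimes> b) = a \<otimes> h \<otimes> b" if "a \<in> carrier R" "b \<in> carrier R" for a b
    using that xy e_closed by (simp add: h m_assoc m_closed e_left)
  have eu: "e \<otimes> (u \<otimes> z) = u \<otimes> z" if "z \<in> carrier R" for z
    using that u e_closed by (metis m_assoc)
  have in_corner: "p \<in> carrier (corner R e)" "p' \<in> carrier (corner R e)"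
      "q \<in> carrier (corner R e)" "q' \<in> carrier (corner R e)"
    unfolding p_def p'_def q_def q'_def mem_corner_iff
    using xy e_closed u v eu by (simp_all add: m_closed m_assoc e_idem e_left)
  have "e \<otimes> h = e"
    using u v e_closed vu by (simp add: h_def r_distr e_idem m_lnull flip: m_assoc)
  then have pq: "p \<otimes> q = e" and pq': "p \<otimes> q' = \<zero>"
    using e_closed v by (simp_all add: p_def q_def q'_def mult e_idem)
  have "u \<otimes> h = u \<otimes> v \<otimes> u"
    using u v e_closed vu m_closed by (simp add: h_def r_distr flip: m_assoc)
  then have p'q': "p' \<otimes> q' = (u \<otimes> v) \<otimes> (u \<otimes> v)"
    using u v by (simp add: p'_def q'_def mult m_assoc m_closed)
  have "p \<notin> I"
    using I.I_r_closed[of p q] in_corner pq e_notin by (auto simp: corner_simps)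
  then have "q' \<in> I"
    using completely_prime[of p q'] in_corner pq' I.zero_closed by (simp add: corner_simps)
  then have "(u \<otimes> v) \<otimes> (u \<otimes> v) \<in> I"
    using I.I_l_closed[of q' p'] in_corner p'q' by (simp add: corner_simps)
  then show False using completely_prime uv notin by blast
qed

text \<open>Compression is multiplicative modulo \<open>I\<close>: the defect is the product of an element orthogonal
  to \<open>e\<close> on the right and one orthogonal to \<open>e\<close> on the left.\<close>

lemma compress_mult_modulo:
  assumes "purely_infinite_ring R" "x \<in> carrier R" "y \<in> carrier R"
  shows "e \<otimes> (x \<otimes> y) \<otimes> e \<ominus> (e \<otimes> x \<otimes> e) \<otimes> (e \<otimes> y \<otimes> e) \<in> I"
proof -
  define u v where "u = e \<otimes> x \<ominus> e \<otimes> x \<otimes> e" and "v = y \<otimes> e \<ominus> e \<otimes> y \<otimes> e"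
  have u: "u \<in> carrier R" "e \<otimes> u = u" "u \<otimes> e = \<zero>"
    using assms e_closed
    by (simp_all add: u_def m_closed diff_distr_left diff_distr_right m_assoc e_left e_idem diff_self)
  have v: "v \<in> carrier R" "v \<otimes> e = v" "e \<otimes> v = \<zero>"
    using assms e_closed
    by (simp_all add: v_def m_closed diff_distr_left diff_distr_right m_assoc e_left e_idem diff_self)
  have "u \<otimes> v = u \<otimes> (y \<otimes> e) \<ominus> (u \<otimes> e) \<otimes> (y \<otimes> e)"
    using u(1) assms e_closed by (simp add: v_def diff_distr_right m_assoc m_closed)
  also have "\<dots> = u \<otimes> (y \<otimes> e)"
    using u assms e_closed by (simp add: m_closed m_lnull a_minus_def)
  also have "\<dots> = e \<otimes> (x \<otimes> y) \<otimes> e \<ominus> (e \<otimes> x \<otimes> e) \<otimes> (e \<otimes> y \<otimes> e)"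
    using assms e_closed by (simp add: u_def diff_distr_left m_assoc m_closed e_left)
  finally show ?thesis
    using orthogonal_product_in_ideal[OF assms(1) u v] by simp
qed

text \<open>The kernel of the homomorphism \<open>x \<mapsto> exe + I\<close> from \<open>R\<close> to \<open>eRe/I\<close>.\<close>

definition compression_kernel where
  "compression_kernel = {x \<in> carrier R. e \<otimes> x \<otimes> e \<in> I}"

lemma compression_kernel_diff_iff:
  assumes "x \<in> carrier R" "y \<in> carrier R"
  shows "x \<ominus> y \<in> compression_kernel \<longleftrightarrow> e \<otimes> x \<otimes> e \<ominus> e \<otimes> y \<otimes> e \<in> I"
proof -
  have "e \<otimes> (x \<ominus> y) \<otimes> e = e \<otimes> x \<otimes> e \<ominus> e \<otimes> y \<otimes> e"
    using assms e_closed diff_distr_left diff_distr_right m_closed by metis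
  then show ?thesis using assms unfolding compression_kernel_def by simp
qed

lemma compress_mult_mem_iff:
  assumes "purely_infinite_ring R" "x \<in> carrier R" "y \<in> carrier R"
  shows "e \<otimes> (x \<otimes> y) \<otimes> e \<in> I \<longleftrightarrow> (e \<otimes> x \<otimes> e) \<otimes> (e \<otimes> y \<otimes> e) \<in> I"
proof (rule I.mem_diff_trans)
  show a: "e \<otimes> (x \<otimes> y) \<otimes> e \<in> carrier (corner R e)"
    using assms m_closed compress_in_corner by blast
  show b: "(e \<otimes> x \<otimes> e) \<otimes> (e \<otimes> y \<otimes> e) \<in> carrier (corner R e)"
    using C.m_closed compress_in_corner assms by (simp add: corner_simps)
  show "e \<otimes> (x \<otimes> y) \<otimes> e \<ominus>\<^bsub>corner R e\<^esub> (e \<otimes> x \<otimes> e) \<otimes> (e \<otimes> y \<otimes> e) \<in> I"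
    using compress_mult_modulo assms corner_minus[OF a b] by simp
qed

lemma compression_kernel_ideal:
  assumes "purely_infinite_ring R"
  shows "rng_ideal compression_kernel R"
proof -
  have "subgroup compression_kernel (add_monoid R)"
  proof (rule add.subgroupI)
    show "compression_kernel \<noteq> {}"
      using I.zero_closed e_closed
      by (auto simp: compression_kernel_def corner_simps m_lnull m_rnull intro!: exI[of _ \<zero>])
    show "\<ominus> x \<in> compression_kernel" if "x \<in> compression_kernel" for x
    proof -
      have x: "x \<in> carrier R" "e \<otimes> x \<otimes> e \<in> I" using that by (auto simp: compression_kernel_def)
      have "\<ominus> (e \<otimes> x \<otimes> e) = \<zero> \<ominus> e \<otimes> x \<otimes> e"
        using x e_closed by (simp add: a_minus_def m_closed)
      also have "\<dots> = \<zero>\<^bsub>corner R e\<^esub> \<ominus>\<^bsub>corner R e\<^esub> e \<otimes> x \<otimes> e"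
        using corner_minus[of \<zero> "e \<otimes> x \<otimes> e"] C.zero_closed compress_in_corner x
        by (simp add: corner_simps)
      also have "\<dots> \<in> I" using x(2) by (simp add: a_minus_def)
      finally show ?thesis
        using x e_closed by (simp add: compression_kernel_def m_lminus m_rminus m_closed)
    qed
    show "x \<oplus> y \<in> compression_kernel" if "x \<in> compression_kernel" "y \<in> compression_kernel" for x y
      using that I.a_closed[of "e \<otimes> x \<otimes> e" "e \<otimes> y \<otimes> e"] e_closed
      by (simp add: compression_kernel_def l_distr r_distr m_closed corner_simps)
  qed (auto simp: compression_kernel_def)
  moreover have "x \<otimes> a \<in> compression_kernel" "a \<otimes> x \<in> compression_kernel"
    if "a \<in> compression_kernel" "x \<in> carrier R" for a x
  proof -
    have a: "a \<in> carrier R" "e \<otimes> a \<otimes> e \<in> I" using that by (auto simp: compression_kernel_def)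
    have "(e \<otimes> x \<otimes> e) \<otimes> (e \<otimes> a \<otimes> e) \<in> I" "(e \<otimes> a \<otimes> e) \<otimes> (e \<otimes> x \<otimes> e) \<in> I"
      using I.I_l_closed[OF a(2)] I.I_r_closed[OF a(2)] compress_in_corner that(2)
      by (simp_all add: corner_simps)
    then show "x \<otimes> a \<in> compression_kernel" "a \<otimes> x \<in> compression_kernel"
      using compress_mult_mem_iff assms a that(2) m_closed by (auto simp: compression_kernel_def)
  qed
  ultimately show ?thesis
    by (intro rng_ideal.intro additive_subgroup.intro rng_ideal_axioms.intro rng_axioms)
qed

text \<open>Modulo the kernel, \<open>e\<close> is a unit since \<open>ex\<close>, \<open>xe\<close> and \<open>x\<close> have the same compression, and an
  inverse of \<open>exe\<close> in the corner modulo \<open>I\<close> is an inverse of \<open>x\<close>, because multiplication by an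
  element of the corner commutes with compression exactly.\<close>

lemma quotient_by_compression_kernel_division:
  assumes "purely_infinite_ring R"
  shows "is_division_ring (R Quot compression_kernel)"
proof -
  interpret K: rng_ideal compression_kernel R using assms by (rule compression_kernel_ideal)
  have "\<zero> \<in> I" using I.zero_closed by (simp add: corner_simps)
  have "e \<notin> compression_kernel" using e_notin e_idem unfolding compression_kernel_def by simp
  moreover have "e \<otimes> x \<ominus> x \<in> compression_kernel" "x \<otimes> e \<ominus> x \<in> compression_kernel"
    if "x \<in> carrier R" for x
    using that e_closed \<open>\<zero> \<in> I\<close>
    by (simp_all add: compression_kernel_diff_iff m_closed m_assoc e_left e_idem diff_self)
  moreover have "\<exists>y \<in> carrier R. x \<otimes> y \<ominus> e \<in> compression_kernel \<and> y \<otimes> x \<ominus> e \<in> compression_kernel"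
    if "x \<in> carrier R - compression_kernel" for x
  proof -
    have x: "x \<in> carrier R" "e \<otimes> x \<otimes> e \<notin> I" using that unfolding compression_kernel_def by auto
    then obtain y where y: "y \<in> carrier (corner R e)"
        "(e \<otimes> x \<otimes> e) \<otimes> y \<ominus> e \<in> I" "y \<otimes> (e \<otimes> x \<otimes> e) \<ominus> e \<in> I"
      using inverse_modulo compress_in_corner by blast
    have y': "y \<in> carrier R" "e \<otimes> y = y" "y \<otimes> e = y" using y(1) by (auto simp: mem_corner_iff)
    have "y \<otimes> (e \<otimes> z) = y \<otimes> z" "e \<otimes> (y \<otimes> z) = y \<otimes> z" if "z \<in> carrier R" for z
      using that y' e_closed by (metis m_assoc)+
    then have "e \<otimes> (x \<otimes> y) \<otimes> e = (e \<otimes> x \<otimes> e) \<otimes> y" "e \<otimes> (y \<otimes> x) \<otimes> e = y \<otimes> (e \<otimes> x \<otimes> e)"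
      using y' x(1) e_closed by (simp_all add: m_assoc m_closed)
    then show ?thesis
      using y y' x(1) e_closed
      by (auto simp: compression_kernel_diff_iff m_closed e_idem intro!: bexI[of _ y])
  qed
  ultimately show ?thesis
    unfolding K.quotient_is_division_ring_iff using e_closed by blast
qed

end

theorem proposition5p2:
  fixes R (structure) and e
  assumes "rng R" and "e \<in> carrier R" and "e \<otimes> e = e"
  shows "(purely_infinite_ring R \<longrightarrow> purely_infinite_ring (corner R e)) \<and>
         (properly_purely_infinite_ring R \<longrightarrow> properly_purely_infinite_ring (corner R e))"
proof (intro conjI impI)
  interpret rng_idempotent R e
    by (intro rng_idempotent.intro rng_idempotent_axioms.intro assms)
  assume P: "purely_infinite_ring R"
  show "purely_infinite_ring (corner R e)"
  proof (intro purely_infinite_ring.intro purely_infinite_ring_axioms.intro corner_rng)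
    show "\<not> is_division_ring (corner R e Quot I)" if "rng_ideal I (corner R e)" for I
    proof
      assume D: "is_division_ring (corner R e Quot I)"
      interpret corner_division_ideal R e I
        by (intro corner_division_ideal.intro corner_division_ideal_axioms.intro
            rng_idempotent_axioms that D)
      show False
        by (rule notE[OF purely_infinite_ring.no_division_ring_quotient
              [OF P compression_kernel_ideal[OF P]]
              quotient_by_compression_kernel_division[OF P]])
    qed
    show "\<exists>x \<in> carrier (corner R e). \<exists>y \<in> carrier (corner R e).
        b = x \<otimes>\<^bsub>corner R e\<^esub> a \<otimes>\<^bsub>corner R e\<^esub> y"
      if "a \<in> carrier (corner R e)" "b \<in> two_sided_multiples (corner R e) a" for a b
      using corner_multiples[OF P] that by (simp add: corner_simps)
  qed
next
  interpret rng_idempotent R e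
    by (intro rng_idempotent.intro rng_idempotent_axioms.intro assms)
  assume P: "properly_purely_infinite_ring R"
  show "properly_purely_infinite_ring (corner R e)"
  proof (intro properly_purely_infinite_ring.intro properly_purely_infinite_ring_axioms.intro
      corner_rng)
    show "properly_infinite (corner R e) a"
      if "a \<in> carrier (corner R e)" "a \<noteq> \<zero>\<^bsub>corner R e\<^esub>" for a
      using corner_properly_infinite properly_purely_infinite_ring.properly_infinite[OF P] that
      by (simp add: corner_simps mem_corner_iff)
  qed
qed

end
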